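(* There exists $x\in JT_\infty$ with $\|x\|=1$ such that $$\inf_{\alpha>0}\operatorname{diam} S(B_{JT_\infty^*},x,\alpha)\leq \sqrt{2}.$$
   Context: All Banach spaces are real. For a Banach space $X$, $B_X$ is its closed unit ball and $X^*$ its topological dual; for $x\in X$, $\alpha>0$ and bounded $B\subseteq X^*$, the $w^*$-slice is $S(B,x,\alpha)=\{x^*\in B: x^*(x)>\sup_{y^*\in B}y^*(x)-\alpha\}$. Diameters are with respect to the norm. The tree: $T=\{\emptyset\}\cup\{(\alpha_1,\ldots,\alpha_k): k\in\mathbb N,\ \alpha_1,\ldots,\alpha_k\in\mathbb N\}$ is the set of finite sequences of natural numbers, partially ordered by initial-segment extension: $(\alpha_1,\ldots,\alpha_k)\le(\beta_1,\ldots,\beta_p)$ iff $k\le p$ and $\alpha_i=\beta_i$ for $1\le i\le k$, with $\emptyset$ the least element. A segment is a non-empty finite interval of $T$, i.e. a set $\{t\in T: s\le t\le s'\}$ with $s\le s'$ in $T$. $JT_\infty$ is the completion of the space of finitely nonzero functions $x:T\to\mathbb R$ under the norm $$\|x\|=\sup\Big(\sum_{i=1}^n\big(\sum_{t\in S_i}x(t)\big)^2\Big)^{1/2},$$ the supremum being over all finite families $\{S_1,\ldots,S_n\}$ of pairwise disjoint segments of $T$. *)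

theory Defs
  imports "HOL-Analysis.Analysis" "HOL-Library.Sublist"
begin

text \<open>
  The tree \<open>T\<close> of finite sequences of natural numbers is the type \<open>nat list\<close>, ordered by
  \<^const>\<open>prefix\<close>.
\<close>

definition segment :: "nat list set \<Rightarrow> bool" where
  "segment S \<longleftrightarrow> (\<exists>s s'. prefix s s' \<and> S = {t. prefix s t \<and> prefix t s'})"

text \<open>Segments are non-empty, so pairwise disjoint ones are distinct and a finite disjoint family
  may be taken to be a set. The empty family only contributes the value \<open>0\<close> to the supremum.\<close>

definition segment_families :: "nat list set set set" where
  "segment_families = {F. finite F \<and> (\<forall>S\<in>F. segment S) \<and> disjoint F}"

definition finitely_nonzero :: "(nat list \<Rightarrow> real) set" where
  "finitely_nonzero = {x. finite {t. x t \<noteq> 0}}"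

definition segsum :: "nat list set set \<Rightarrow> (nat list \<Rightarrow> real) \<Rightarrow> real" where
  "segsum F x = sqrt (\<Sum>S\<in>F. (\<Sum>t\<in>S. x t)\<^sup>2)"

text \<open>\<open>jt_norm\<close> is meaningful only where the supremum is finite, e.g. on \<open>finitely_nonzero\<close>
  (\<open>segment_sums_bdd_above\<close> below).\<close>

definition jt_norm :: "(nat list \<Rightarrow> real) \<Rightarrow> real" where
  "jt_norm x = (SUP F\<in>segment_families. segsum F x)"

text \<open>
  The completion is realised as a space of functions: those functions on the tree that are
  limits of finitely nonzero ones. The inner universal quantifier says that \<open>x - y\<close> has norm
  at most \<open>e\<close> (and, in particular, that the supremum is finite). That this space, with \<open>jt_norm\<close>,
  is indeed the completion of \<open>finitely_nonzero\<close> is proved below: it is a Banach space (the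
  \<open>banach\<close> instance), its operations and its norm extend those of \<open>finitely_nonzero\<close>
  (\<open>jt_of_add\<close>, \<open>jt_of_scaleR\<close>, \<open>norm_jt_of\<close>), and \<open>finitely_nonzero\<close> is dense
  (\<open>closure_jt_of\<close>).
\<close>

definition jt_space :: "(nat list \<Rightarrow> real) set" where
  "jt_space = {x. \<forall>e>0. \<exists>y\<in>finitely_nonzero. \<forall>F\<in>segment_families.
     segsum F (\<lambda>t. x t - y t) \<le> e}"

lemma segsum_L2: "segsum F x = L2_set (\<lambda>S. \<Sum>t\<in>S. x t) F"
  by (simp add: segsum_def L2_set_def)

lemma segsum_nonneg: "0 \<le> segsum F x"
  by (simp add: segsum_def sum_nonneg)

lemma segsum_add: "segsum F (\<lambda>t. x t + y t) \<le> segsum F x + segsum F y"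
  unfolding segsum_L2 sum.distrib by (rule L2_set_triangle_ineq)

lemma segsum_scale: "segsum F (\<lambda>t. r * x t) = \<bar>r\<bar> * segsum F x"
  by (simp add: segsum_def sum_distrib_left[symmetric] power_mult_distrib real_sqrt_mult)

lemma finite_segment: "segment S \<Longrightarrow> finite S"
proof -
  assume "segment S"
  then obtain s s' where "S = {t. prefix s t \<and> prefix t s'}"
    by (auto simp: segment_def)
  then have "S \<subseteq> set (prefixes s')" by auto
  then show ?thesis by (rule finite_subset) simp
qed

lemma segment_singleton: "segment {t}"
  unfolding segment_def by (rule exI[of _ t], rule exI[of _ t]) auto

lemma singleton_family: "{{t}} \<in> segment_families"
  by (simp add: segment_families_def segment_singleton)

lemma segment_families_nonempty: "segment_families \<noteq> {}"
  using singleton_family by blast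

lemma finitely_nonzero_bound:
  assumes "y \<in> finitely_nonzero" "F \<in> segment_families"
  shows "segsum F y \<le> (\<Sum>t | y t \<noteq> 0. \<bar>y t\<bar>)"
proof -
  have fin: "finite F" "\<forall>S\<in>F. finite S" and dis: "disjoint F"
    using assms(2) finite_segment by (auto simp: segment_families_def)
  have fy: "finite {t. y t \<noteq> 0}"
    using assms(1) by (simp add: finitely_nonzero_def)
  have "segsum F y \<le> (\<Sum>S\<in>F. \<bar>\<Sum>t\<in>S. y t\<bar>)"
    unfolding segsum_L2 by (rule L2_set_le_sum_abs)
  also have "\<dots> \<le> (\<Sum>S\<in>F. \<Sum>t\<in>S. \<bar>y t\<bar>)"
    by (intro sum_mono sum_abs)
  also have "\<dots> = (\<Sum>t\<in>\<Union>F. \<bar>y t\<bar>)"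
    using fin dis by (subst sum.Union_disjoint) (auto simp: pairwise_def disjnt_def)
  also have "\<dots> = (\<Sum>t\<in>\<Union>F \<inter> {t. y t \<noteq> 0}. \<bar>y t\<bar>)"
    using fin by (intro sum.mono_neutral_right) auto
  also have "\<dots> \<le> (\<Sum>t | y t \<noteq> 0. \<bar>y t\<bar>)"
    using fy by (intro sum_mono2) auto
  finally show ?thesis .
qed

lemma jt_space_bdd:
  assumes "x \<in> jt_space"
  shows "bdd_above ((\<lambda>F. segsum F x) ` segment_families)"
proof -
  have "\<exists>y\<in>finitely_nonzero. \<forall>F\<in>segment_families. segsum F (\<lambda>t. x t - y t) \<le> 1"
    using assms unfolding jt_space_def mem_Collect_eq by (rule allE[of _ 1]) simp
  then obtain y where y: "y \<in> finitely_nonzero"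
    "\<And>F. F \<in> segment_families \<Longrightarrow> segsum F (\<lambda>t. x t - y t) \<le> 1"
    by blast
  have "segsum F x \<le> 1 + (\<Sum>t | y t \<noteq> 0. \<bar>y t\<bar>)" if "F \<in> segment_families" for F
    using segsum_add[where F = F and x = "\<lambda>t. x t - y t" and y = y] y(2)[OF that]
      finitely_nonzero_bound[OF y(1) that] by simp
  then show ?thesis by (intro bdd_aboveI2)
qed

lemma finitely_nonzero_subset: "finitely_nonzero \<subseteq> jt_space"
proof
  fix x assume "x \<in> finitely_nonzero"
  then show "x \<in> jt_space"
    unfolding jt_space_def by (auto intro!: bexI[of _ x] simp: segsum_def)
qed

lemma segment_sums_bdd_above:
  "x \<in> finitely_nonzero \<Longrightarrow> bdd_above ((\<lambda>F. segsum F x) ` segment_families)"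
  by (rule jt_space_bdd) (rule subsetD[OF finitely_nonzero_subset])

lemma segsum_le_norm: "x \<in> jt_space \<Longrightarrow> F \<in> segment_families \<Longrightarrow> segsum F x \<le> jt_norm x"
  unfolding jt_norm_def by (intro cSUP_upper jt_space_bdd)

lemma jt_norm_le: "(\<And>F. F \<in> segment_families \<Longrightarrow> segsum F x \<le> c) \<Longrightarrow> jt_norm x \<le> c"
  unfolding jt_norm_def by (intro cSUP_least segment_families_nonempty)

lemma coord_le_norm: "x \<in> jt_space \<Longrightarrow> \<bar>x t\<bar> \<le> jt_norm x"
  using segsum_le_norm[OF _ singleton_family[of t], of x] by (simp add: segsum_def)

lemma finitely_nonzero_zero: "(\<lambda>t. 0) \<in> finitely_nonzero"
  by (simp add: finitely_nonzero_def)

lemma finitely_nonzero_add: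
  assumes "x \<in> finitely_nonzero" "y \<in> finitely_nonzero"
  shows "(\<lambda>t. x t + y t) \<in> finitely_nonzero"
proof -
  have "finite ({t. x t \<noteq> 0} \<union> {t. y t \<noteq> 0})"
    using assms by (simp add: finitely_nonzero_def)
  then show ?thesis
    unfolding finitely_nonzero_def mem_Collect_eq by (rule rev_finite_subset) auto
qed

lemma finitely_nonzero_scale:
  assumes "x \<in> finitely_nonzero"
  shows "(\<lambda>t. r * x t) \<in> finitely_nonzero"
  using assms unfolding finitely_nonzero_def mem_Collect_eq by (rule rev_finite_subset) auto

lemma jt_norm_zero: "jt_norm (\<lambda>t. 0) = 0"
  using segment_families_nonempty by (simp add: jt_norm_def segsum_def)

lemma jt_space_zero: "(\<lambda>t. 0) \<in> jt_space"
  using finitely_nonzero_zero finitely_nonzero_subset by blast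

lemma jt_space_add:
  assumes "x \<in> jt_space" "y \<in> jt_space"
  shows "(\<lambda>t. x t + y t) \<in> jt_space"
  unfolding jt_space_def mem_Collect_eq
proof (intro allI impI)
  fix e :: real assume "e > 0"
  then have e: "e / 2 > 0" by simp
  obtain u where u: "u \<in> finitely_nonzero"
    "\<And>F. F \<in> segment_families \<Longrightarrow> segsum F (\<lambda>t. x t - u t) \<le> e / 2"
    using assms(1) e unfolding jt_space_def by blast
  obtain v where v: "v \<in> finitely_nonzero"
    "\<And>F. F \<in> segment_families \<Longrightarrow> segsum F (\<lambda>t. y t - v t) \<le> e / 2"
    using assms(2) e unfolding jt_space_def by blast
  have "segsum F (\<lambda>t. x t + y t - (u t + v t)) \<le> e" if "F \<in> segment_families" for F
    using segsum_add[where F = F and x = "\<lambda>t. x t - u t" and y = "\<lambda>t. y t - v t"] u(2)[OF that] v(2)[OF that]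
    by (simp add: algebra_simps)
  then show "\<exists>w\<in>finitely_nonzero. \<forall>F\<in>segment_families.
      segsum F (\<lambda>t. x t + y t - w t) \<le> e"
    using finitely_nonzero_add[OF u(1) v(1)] by (intro bexI[of _ "\<lambda>t. u t + v t"]) auto
qed

lemma jt_space_scale:
  assumes "x \<in> jt_space"
  shows "(\<lambda>t. r * x t) \<in> jt_space"
  unfolding jt_space_def mem_Collect_eq
proof (intro allI impI)
  fix e :: real assume "e > 0"
  then have e: "e / (\<bar>r\<bar> + 1) > 0" by simp
  obtain u where u: "u \<in> finitely_nonzero"
    "\<And>F. F \<in> segment_families \<Longrightarrow> segsum F (\<lambda>t. x t - u t) \<le> e / (\<bar>r\<bar> + 1)"
    using assms(1) e unfolding jt_space_def by blast
  have "segsum F (\<lambda>t. r * x t - r * u t) \<le> e" if "F \<in> segment_families" for F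
  proof -
    have "segsum F (\<lambda>t. r * x t - r * u t) = \<bar>r\<bar> * segsum F (\<lambda>t. x t - u t)"
      by (simp add: segsum_scale[symmetric] right_diff_distrib)
    also have "\<dots> \<le> (\<bar>r\<bar> + 1) * (e / (\<bar>r\<bar> + 1))"
      by (intro mult_mono u that segsum_nonneg) auto
    also have "\<dots> = e" by (simp add: add_nonneg_eq_0_iff)
    finally show ?thesis .
  qed
  then show "\<exists>w\<in>finitely_nonzero. \<forall>F\<in>segment_families.
      segsum F (\<lambda>t. r * x t - w t) \<le> e"
    using finitely_nonzero_scale[OF u(1)] by (intro bexI[of _ "\<lambda>t. r * u t"]) auto
qed

typedef jt_infty = jt_space
  morphisms jt_coord jt_of
  using jt_space_zero by blast

setup_lifting type_definition_jt_infty

instantiation jt_infty :: real_normed_vector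
begin

lift_definition zero_jt_infty :: jt_infty is "\<lambda>t. 0"
  by (rule jt_space_zero)

lift_definition plus_jt_infty :: "jt_infty \<Rightarrow> jt_infty \<Rightarrow> jt_infty" is "\<lambda>x y t. x t + y t"
  by (rule jt_space_add)

lift_definition scaleR_jt_infty :: "real \<Rightarrow> jt_infty \<Rightarrow> jt_infty" is "\<lambda>r x t. r * x t"
  by (rule jt_space_scale)

lift_definition uminus_jt_infty :: "jt_infty \<Rightarrow> jt_infty" is "\<lambda>x t. - x t"
  using jt_space_scale[of _ "-1"] by simp

lift_definition minus_jt_infty :: "jt_infty \<Rightarrow> jt_infty \<Rightarrow> jt_infty" is "\<lambda>x y t. x t - y t"
  using jt_space_add[OF _ jt_space_scale[of _ "-1"]] by simp

lift_definition norm_jt_infty :: "jt_infty \<Rightarrow> real" is jt_norm .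

definition dist_jt_infty :: "jt_infty \<Rightarrow> jt_infty \<Rightarrow> real" where
  "dist_jt_infty x y = norm (x - y)"

definition sgn_jt_infty :: "jt_infty \<Rightarrow> jt_infty" where
  "sgn_jt_infty x = scaleR (inverse (norm x)) x"

definition uniformity_jt_infty :: "(jt_infty \<times> jt_infty) filter" where
  "uniformity_jt_infty = (INF e\<in>{0<..}. principal {(x, y). dist x y < e})"

definition open_jt_infty :: "jt_infty set \<Rightarrow> bool" where
  "open_jt_infty U \<longleftrightarrow> (\<forall>x\<in>U. \<forall>\<^sub>F (x', y) in uniformity. x' = x \<longrightarrow> y \<in> U)"

instance
proof
  fix x y z :: jt_infty and a b :: real and U :: "jt_infty set"
  show "x + y + z = x + (y + z)" by transfer (simp add: algebra_simps)
  show "x + y = y + x" by transfer (simp add: algebra_simps)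
  show "0 + x = x" by transfer simp
  show "- x + x = 0" by transfer simp
  show "x - y = x + - y" by transfer simp
  show "a *\<^sub>R (x + y) = a *\<^sub>R x + a *\<^sub>R y" by transfer (simp add: algebra_simps)
  show "(a + b) *\<^sub>R x = a *\<^sub>R x + b *\<^sub>R x" by transfer (simp add: algebra_simps)
  show "a *\<^sub>R b *\<^sub>R x = (a * b) *\<^sub>R x" by transfer (simp add: algebra_simps)
  show "1 *\<^sub>R x = x" by transfer simp
  show "dist x y = norm (x - y)" by (rule dist_jt_infty_def)
  show "sgn x = scaleR (inverse (norm x)) x" by (rule sgn_jt_infty_def)
  show "uniformity = (INF e\<in>{0<..}. principal {(x, y). dist x (y::jt_infty) < e})"
    by (rule uniformity_jt_infty_def)
  show "open U = (\<forall>x\<in>U. \<forall>\<^sub>F (x', y) in uniformity. x' = x \<longrightarrow> y \<in> U)"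
    by (rule open_jt_infty_def)
  show "(norm x = 0) = (x = 0)"
  proof transfer
    fix x assume x: "x \<in> jt_space"
    have "x = (\<lambda>t. 0)" if "jt_norm x = 0"
    proof
      show "x t = 0" for t using coord_le_norm[OF x, of t] that by simp
    qed
    moreover have "jt_norm (\<lambda>t. 0) = 0"
      using jt_norm_zero by simp
    ultimately show "(jt_norm x = 0) = (x = (\<lambda>t. 0))" by auto
  qed
  show "norm (x + y) \<le> norm x + norm y"
  proof transfer
    fix x y assume xy: "x \<in> jt_space" "y \<in> jt_space"
    show "jt_norm (\<lambda>t. x t + y t) \<le> jt_norm x + jt_norm y"
      by (rule jt_norm_le, rule order_trans[OF segsum_add])
         (intro add_mono segsum_le_norm xy)
  qed
  show "norm (a *\<^sub>R x) = \<bar>a\<bar> * norm x"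
  proof transfer
    fix a :: real and x assume x: "x \<in> jt_space"
    have le: "jt_norm (\<lambda>t. c * z t) \<le> \<bar>c\<bar> * jt_norm z" if "z \<in> jt_space" for c z
      using that
      by (intro jt_norm_le) (simp only: segsum_scale, intro mult_left_mono segsum_le_norm, auto)
    show "jt_norm (\<lambda>t. a * x t) = \<bar>a\<bar> * jt_norm x"
    proof (cases "a = 0")
      case True
      then show ?thesis
        using jt_norm_zero by simp
    next
      case False
      have "jt_norm x \<le> \<bar>inverse a\<bar> * jt_norm (\<lambda>t. a * x t)"
        using le[OF jt_space_scale[OF x, of a], of "inverse a"] False
        by (simp add: mult.assoc[symmetric])
      then have "\<bar>a\<bar> * jt_norm x \<le> jt_norm (\<lambda>t. a * x t)"
        using False by (simp add: field_simps)
      then show ?thesis using le[OF x, of a] by simp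
    qed
  qed
qed

end

instance jt_infty :: banach
proof
  fix X :: "nat \<Rightarrow> jt_infty" assume X: "Cauchy X"
  let ?x = "\<lambda>n. jt_coord (X n)"
  have coord: "\<bar>?x m t - ?x n t\<bar> \<le> norm (X m - X n)" for m n t
    using coord_le_norm[OF jt_coord[of "X m - X n"], of t]
    by (simp add: norm_jt_infty.rep_eq minus_jt_infty.rep_eq)
  have "Cauchy (\<lambda>n. ?x n t)" for t
  proof (rule CauchyI)
    fix e :: real assume "e > 0"
    then obtain M where "\<forall>m\<ge>M. \<forall>n\<ge>M. norm (X m - X n) < e"
      using CauchyD[OF X] by blast
    then show "\<exists>M. \<forall>m\<ge>M. \<forall>n\<ge>M. norm (?x m t - ?x n t) < e"
      using coord[of _ t] by (metis real_norm_def le_less_trans)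
  qed
  then have "\<forall>t. \<exists>l. (\<lambda>n. ?x n t) \<longlonglongrightarrow> l"
    by (simp add: Cauchy_convergent_iff convergent_def)
  then obtain z where z: "\<And>t. (\<lambda>n. ?x n t) \<longlonglongrightarrow> z t"
    by metis
  have close: "\<exists>M. \<forall>n\<ge>M. \<forall>F\<in>segment_families. segsum F (\<lambda>t. z t - ?x n t) \<le> e"
    if e: "e > 0" for e
  proof -
    obtain M where M: "\<And>m n. m \<ge> M \<Longrightarrow> n \<ge> M \<Longrightarrow> norm (X m - X n) < e"
      using CauchyD[OF X e] by metis
    have "segsum F (\<lambda>t. z t - ?x n t) \<le> e" if n: "n \<ge> M" and F: "F \<in> segment_families" for n F
    proof (rule tendsto_upperbound)
      show "(\<lambda>m. segsum F (\<lambda>t. ?x m t - ?x n t)) \<longlonglongrightarrow> segsum F (\<lambda>t. z t - ?x n t)"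
        unfolding segsum_def by (intro tendsto_intros z)
      have "segsum F (\<lambda>t. ?x m t - ?x n t) \<le> e" if "m \<ge> M" for m
        using segsum_le_norm[OF jt_coord[of "X m - X n"] F] M[OF that n]
        by (simp add: norm_jt_infty.rep_eq minus_jt_infty.rep_eq)
      then show "\<forall>\<^sub>F m in sequentially. segsum F (\<lambda>t. ?x m t - ?x n t) \<le> e"
        by (auto simp: eventually_sequentially)
    qed simp
    then show ?thesis by blast
  qed
  have "z \<in> jt_space"
    unfolding jt_space_def mem_Collect_eq
  proof (intro allI impI)
    fix e :: real assume "e > 0"
    then have e: "e / 2 > 0" by simp
    obtain n where n: "\<And>F. F \<in> segment_families \<Longrightarrow> segsum F (\<lambda>t. z t - ?x n t) \<le> e / 2"
      using close[OF e] by blast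
    obtain u where u: "u \<in> finitely_nonzero"
      "\<And>F. F \<in> segment_families \<Longrightarrow> segsum F (\<lambda>t. ?x n t - u t) \<le> e / 2"
      using jt_coord[of "X n"] e unfolding jt_space_def by blast
    have "segsum F (\<lambda>t. z t - u t) \<le> e" if "F \<in> segment_families" for F
      using segsum_add[where F = F and x = "\<lambda>t. z t - ?x n t" and y = "\<lambda>t. ?x n t - u t"] u(2)[OF that] n[OF that]
      by simp
    then show "\<exists>w\<in>finitely_nonzero. \<forall>F\<in>segment_families. segsum F (\<lambda>t. z t - w t) \<le> e"
      using u(1) by blast
  qed
  then have zc: "jt_coord (jt_of z) = z" by (rule jt_of_inverse)
  have "X \<longlonglongrightarrow> jt_of z"
  proof (rule LIMSEQ_I)
    fix r :: real assume "r > 0"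
    then have r: "r / 2 > 0" by simp
    obtain M where M: "\<And>n F. n \<ge> M \<Longrightarrow> F \<in> segment_families \<Longrightarrow> segsum F (\<lambda>t. z t - ?x n t) \<le> r / 2"
      using close[OF r] by blast
    have "norm (jt_of z - X n) \<le> r / 2" if "n \<ge> M" for n
      unfolding norm_jt_infty.rep_eq minus_jt_infty.rep_eq zc
      by (intro jt_norm_le M that)
    then show "\<exists>no. \<forall>n\<ge>no. norm (X n - jt_of z) < r"
      using \<open>r > 0\<close> by (intro exI[of _ M]) (force simp: norm_minus_commute)
  qed
  then show "convergent X" by (auto simp: convergent_def)
qed

lemma jt_of_add:
  "x \<in> finitely_nonzero \<Longrightarrow> y \<in> finitely_nonzero \<Longrightarrow> jt_of (\<lambda>t. x t + y t) = jt_of x + jt_of y"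
  by (simp add: plus_jt_infty_def jt_of_inverse subsetD[OF finitely_nonzero_subset])

lemma jt_of_scaleR:
  "x \<in> finitely_nonzero \<Longrightarrow> jt_of (\<lambda>t. r * x t) = r *\<^sub>R jt_of x"
  by (simp add: scaleR_jt_infty_def jt_of_inverse subsetD[OF finitely_nonzero_subset])

lemma norm_jt_of: "x \<in> finitely_nonzero \<Longrightarrow> norm (jt_of x) = jt_norm x"
  using finitely_nonzero_subset by (auto simp: norm_jt_infty.rep_eq jt_of_inverse)

lemma closure_jt_of: "closure (jt_of ` finitely_nonzero) = UNIV"
proof -
  have "x \<in> closure (jt_of ` finitely_nonzero)" for x
    unfolding closure_approachable
  proof (intro allI impI)
    fix e :: real assume "e > 0"
    then have e: "e / 2 > 0" by simp
    obtain u where u: "u \<in> finitely_nonzero"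
      "\<And>F. F \<in> segment_families \<Longrightarrow> segsum F (\<lambda>t. jt_coord x t - u t) \<le> e / 2"
      using jt_coord[of x] e unfolding jt_space_def by blast
    have uc: "jt_coord (jt_of u) = u"
      using u(1) finitely_nonzero_subset by (auto simp: jt_of_inverse)
    have "norm (x - jt_of u) \<le> e / 2"
      unfolding norm_jt_infty.rep_eq minus_jt_infty.rep_eq uc
      by (intro jt_norm_le u)
    then show "\<exists>y\<in>jt_of ` finitely_nonzero. dist y x < e"
      using u(1) \<open>e > 0\<close> by (intro bexI[of _ "jt_of u"]) (auto simp: dist_norm norm_minus_commute)
  qed
  then show ?thesis by blast
qed

definition wstar_slice ::
    "('a::real_normed_vector \<Rightarrow>\<^sub>L real) set \<Rightarrow> 'a \<Rightarrow> real \<Rightarrow> ('a \<Rightarrow>\<^sub>L real) set" where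
  "wstar_slice B x \<alpha> =
     {f \<in> B. blinfun_apply f x > (SUP g\<in>B. blinfun_apply g x) - \<alpha>}"

end

theory Submission
  imports Defs
begin

text \<open>
  The vector \<open>x = e\<close> at the root works. If \<open>f\<close> and \<open>g\<close> lie in the slice given by \<open>e\<close> and \<open>\<alpha>\<close>,
  then for \<open>\<parallel>z\<parallel> \<le> 1\<close> and \<open>c > 0\<close>, as in the Smulyan lemma,
  \<open>(f - g) z \<le> \<parallel>c e + z\<parallel> + \<parallel>c e - z\<parallel> - 2 c + 2 c \<alpha>\<close>. For large \<open>c\<close> the two norms are nearly
  attained at families dominated by a single segment through the root, so the right-hand side
  is at most \<open>S(z) - S'(z) + 1 / (c - 1) + 2 c \<alpha>\<close> for two initial segments \<open>S\<close>, \<open>S'\<close>. Outside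
  their intersection these leave two disjoint segments, whence \<open>S(z) - S'(z) \<le> \<surd>2 \<parallel>z\<parallel>\<close>.
\<close>

section \<open>Differences of sums over initial segments\<close>

text \<open>The prefixes of \<open>s\<close> form a chain, and by transitivity an extension of a
  non-prefix of \<open>s'\<close> is again no prefix of \<open>s'\<close>. So a nonempty difference
  runs from its shortest element \<open>r\<close> up to \<open>s\<close>.\<close>

lemma segment_prefixes_diff:
  "{t. prefix t s} - {t. prefix t s'} = {} \<or> segment ({t. prefix t s} - {t. prefix t s'})"
proof (rule disjCI)
  let ?D = "{t. prefix t s} - {t. prefix t s'}"
  assume "\<not> segment ?D"
  show "?D = {}"
  proof (rule ccontr)
    assume "?D \<noteq> {}"
    then obtain r where r: "r \<in> ?D" and least: "\<And>t. t \<in> ?D \<Longrightarrow> length r \<le> length t"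
      using exists_least_iff[of "\<lambda>n. \<exists>t\<in>?D. length t = n"] by (metis ex_in_conv not_less)
    have "?D = {t. prefix r t \<and> prefix t s}"
    proof (intro set_eqI iffI)
      fix t assume t: "t \<in> ?D"
      then show "t \<in> {t. prefix r t \<and> prefix t s}"
        using least[OF t] r prefix_length_prefix[of r s t] by auto
    next
      fix t assume "t \<in> {t. prefix r t \<and> prefix t s}"
      then show "t \<in> ?D" using r prefix_order.trans[of r t s'] by auto
    qed
    moreover have "prefix r s" using r by simp
    ultimately have "segment ?D" unfolding segment_def by blast
    with \<open>\<not> segment ?D\<close> show False ..
  qed
qed

lemma segment_root:
  assumes "segment S" "[] \<in> S"
  obtains s where "S = {t. prefix t s}"
  using assms by (auto simp: segment_def)

lemma disjoint_segments_diff_le: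
  assumes w: "w \<in> jt_space" and "A = {} \<or> segment A" "B = {} \<or> segment B" "A \<inter> B = {}"
  shows "sum w A - sum w B \<le> sqrt 2 * jt_norm w"
proof -
  \<comment> \<open>The empty set is not a segment; discarding it changes no sum of squares.\<close>
  let ?F = "{A, B} - {{}}"
  have "?F \<in> segment_families"
    using assms by (auto simp: segment_families_def pairwise_def disjnt_def)
  then have F: "segsum ?F w \<le> jt_norm w" by (rule segsum_le_norm[OF w])
  have "(\<Sum>S\<in>?F. (sum w S)\<^sup>2) = (\<Sum>S\<in>{A, B}. (sum w S)\<^sup>2)"
    by (rule sum.mono_neutral_left) auto
  \<comment> \<open>If \<open>A = B\<close>, disjointness makes both empty and both sides
    \<open>0\<close>.\<close>
  also have "\<dots> = (sum w A)\<^sup>2 + (sum w B)\<^sup>2"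
    using assms(4) by (cases "A = B") auto
  finally have eq: "segsum ?F w = sqrt ((sum w A)\<^sup>2 + (sum w B)\<^sup>2)"
    by (simp add: segsum_def)
  \<comment> \<open>Source of the constant \<open>sqrt 2\<close>: the two sides differ by the square
    of the sum.\<close>
  have "(sum w A - sum w B)\<^sup>2 \<le> 2 * ((sum w A)\<^sup>2 + (sum w B)\<^sup>2)"
    using zero_le_power2[of "sum w A + sum w B"] by (simp add: power2_eq_square algebra_simps)
  then have "sum w A - sum w B \<le> sqrt (2 * ((sum w A)\<^sup>2 + (sum w B)\<^sup>2))"
    by (rule real_le_rsqrt)
  also have "\<dots> \<le> sqrt 2 * jt_norm w"
    unfolding real_sqrt_mult using F eq by (intro mult_left_mono) simp_all
  finally show ?thesis .
qed

lemma initial_segments_diff_le: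
  assumes w: "w \<in> jt_space"
  shows "sum w {t. prefix t s} - sum w {t. prefix t s'} \<le> sqrt 2 * jt_norm w"
proof -
  let ?S = "{t. prefix t s}" and ?S' = "{t. prefix t s'}"
  have fin: "finite ?S" "finite ?S'"
    by (rule finite_subset[of _ "set (prefixes _)"]; auto)+
  have "sum w ?S = sum w (?S - ?S') + sum w (?S \<inter> ?S')"
    "sum w ?S' = sum w (?S' - ?S) + sum w (?S \<inter> ?S')"
    using sum.Int_Diff[OF fin(1), of w ?S'] sum.Int_Diff[OF fin(2), of w ?S]
    by (simp_all add: Int_commute)
  moreover have "sum w (?S - ?S') - sum w (?S' - ?S) \<le> sqrt 2 * jt_norm w"
    by (rule disjoint_segments_diff_le[OF w segment_prefixes_diff segment_prefixes_diff]) auto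
  ultimately show ?thesis by simp
qed

section \<open>Norms near large multiples of the unit vector at the root\<close>

definition root_unit :: "nat list \<Rightarrow> real" where
  "root_unit t = (if t = [] then 1 else 0)"

lemma root_unit_finitely_nonzero: "root_unit \<in> finitely_nonzero"
  by (simp add: finitely_nonzero_def root_unit_def)

lemma root_unit_space: "root_unit \<in> jt_space"
  using root_unit_finitely_nonzero finitely_nonzero_subset by blast

lemma sum_root_unit: "finite S \<Longrightarrow> sum root_unit S = (if [] \<in> S then 1 else 0)"
  by (simp add: root_unit_def[abs_def])

text \<open>The right-hand side is the tangent to the square root at \<open>a\<^sup>2\<close>. With
  \<open>a\<close> close to \<open>c\<close> and \<open>b \<le> 1\<close>, the segments off the root
  cost only about \<open>1 / (2 * c)\<close>.\<close>

lemma sqrt_add_le: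
  assumes "0 < a" "0 \<le> b"
  shows "sqrt (a\<^sup>2 + b) \<le> a + b / (2 * a)"
proof (rule real_le_lsqrt)
  have "(a + b / (2 * a))\<^sup>2 = a\<^sup>2 + b + (b / (2 * a))\<^sup>2"
    using assms by (simp add: power2_sum)
  then show "a\<^sup>2 + b \<le> (a + b / (2 * a))\<^sup>2" by simp
qed (use assms in auto)

text \<open>If \<open>F\<close> misses the root, then \<open>segsum F w \<le> 1\<close>, and the root alone does better as \<open>c \<ge> 2\<close>.\<close>

lemma segsum_root_add_le:
  assumes w: "w \<in> jt_space" "jt_norm w \<le> 1" and c: "2 \<le> c" and F: "F \<in> segment_families"
  obtains s where
    "segsum F (\<lambda>t. c * root_unit t + w t) \<le> c + sum w {t. prefix t s} + 1 / (2 * (c - 1))"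
proof -
  let ?x = "\<lambda>t. c * root_unit t + w t"
  have finF: "finite F" and dis: "disjoint F" and seg: "\<And>S. S \<in> F \<Longrightarrow> segment S"
    using F by (auto simp: segment_families_def)
  have sumx: "sum ?x S = (if [] \<in> S then c else 0) + sum w S" if "S \<in> F" for S
    using finite_segment[OF seg[OF that]]
    by (simp add: sum.distrib sum_distrib_left[symmetric] sum_root_unit)
  have le1: "segsum G w \<le> 1" if "G \<in> segment_families" for G
    using segsum_le_norm[OF w(1) that] w(2) by linarith
  show thesis
  proof (cases "\<exists>S\<in>F. [] \<in> S")
    case True
    then obtain S where S: "S \<in> F" "[] \<in> S" by blast
    have others: "[] \<notin> R" if "R \<in> F - {S}" for R
      using dis that S by (auto simp: pairwise_def disjnt_def)
    obtain s where s: "S = {t. prefix t s}"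
      using segment_root[OF seg[OF S(1)] S(2)] .
    have "{S} \<in> segment_families"
      using seg[OF S(1)] by (simp add: segment_families_def)
    then have abs: "\<bar>sum w S\<bar> \<le> 1"
      using le1 by (fastforce simp: segsum_def)
    let ?b = "\<Sum>R\<in>F - {S}. (sum w R)\<^sup>2"
    have b0: "0 \<le> ?b" by (simp add: sum_nonneg)
    have "?b \<le> (\<Sum>R\<in>F. (sum w R)\<^sup>2)"
      by (rule sum_mono2) (use finF in auto)
    also have "\<dots> \<le> 1" using le1[OF F] by (simp add: segsum_def)
    finally have b1: "?b \<le> 1" .
    have "segsum F ?x = sqrt ((sum ?x S)\<^sup>2 + (\<Sum>R\<in>F - {S}. (sum ?x R)\<^sup>2))"
      unfolding segsum_def by (subst sum.remove[OF finF S(1)]) simp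
    also have "\<dots> = sqrt ((c + sum w S)\<^sup>2 + ?b)"
      using sumx S others by simp
    \<comment> \<open>By \<open>abs\<close> and \<open>c \<ge> 2\<close>, the base point satisfies
      \<open>c + sum w S \<ge> c - 1 \<ge> 1\<close>.\<close>
    also have "\<dots> \<le> c + sum w S + ?b / (2 * (c + sum w S))"
      using abs c b0 by (intro sqrt_add_le) auto
    also have "\<dots> \<le> c + sum w S + 1 / (2 * (c - 1))"
      using abs c b0 b1 by (intro add_left_mono frac_le) auto
    finally show thesis unfolding s by (rule that)
  next
    case False
    then have "segsum F ?x = segsum F w"
      using sumx by (simp add: segsum_def)
    also have "\<dots> \<le> c + w [] + 1 / (2 * (c - 1))"
    proof -
      have "0 \<le> 1 / (2 * (c - 1))" using c by simp
      then show ?thesis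
        using le1[OF F] coord_le_norm[OF w(1), of "[]"] w(2) c by linarith
    qed
    also have "w [] = sum w {t. prefix t []}" by simp
    finally show thesis by (rule that)
  qed
qed

lemma jt_norm_root_add_diff_le:
  assumes w: "w \<in> jt_space" "jt_norm w \<le> 1" and c: "2 \<le> c"
  shows "jt_norm (\<lambda>t. c * root_unit t + w t) + jt_norm (\<lambda>t. c * root_unit t - w t)
    \<le> 2 * c + sqrt 2 + 1 / (c - 1)"
proof -
  let ?C = "2 * c + sqrt 2 + 1 / (c - 1)"
  let ?x = "\<lambda>t. c * root_unit t + w t" and ?y = "\<lambda>t. c * root_unit t - w t"
  have nw: "(\<lambda>t. - w t) \<in> jt_space" using jt_space_scale[OF w(1), of "-1"] by simp
  have "segsum F (\<lambda>t. - w t) = segsum F w" for F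
    by (simp add: segsum_def sum_negf)
  then have nw1: "jt_norm (\<lambda>t. - w t) \<le> 1" using w(2) by (simp add: jt_norm_def)
  have "segsum F ?x + segsum G ?y \<le> ?C" if FG: "F \<in> segment_families" "G \<in> segment_families" for F G
  proof -
    obtain s where s: "segsum F ?x \<le> c + sum w {t. prefix t s} + 1 / (2 * (c - 1))"
      using segsum_root_add_le[OF w c FG(1)] .
    obtain s' where s': "segsum G ?y \<le> c - sum w {t. prefix t s'} + 1 / (2 * (c - 1))"
      using segsum_root_add_le[OF nw nw1 c FG(2)] by (auto simp: sum_negf)
    have "sum w {t. prefix t s} - sum w {t. prefix t s'} \<le> sqrt 2 * jt_norm w"
      by (rule initial_segments_diff_le[OF w(1)])
    also have "\<dots> \<le> sqrt 2" using w(2) by simp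
    finally have "sum w {t. prefix t s} - sum w {t. prefix t s'} \<le> sqrt 2" .
    moreover define h where "h = 1 / (2 * (c - 1))"
    moreover have "1 / (c - 1) = 2 * h"
      using c by (simp add: h_def field_simps)
    ultimately show ?thesis using s s' unfolding h_def[symmetric] by linarith
  qed
  \<comment> \<open>The two suprema are taken in turn: over \<open>F\<close> with \<open>G\<close>
    fixed, then over \<open>G\<close>.\<close>
  then have "jt_norm ?x \<le> ?C - segsum G ?y" if "G \<in> segment_families" for G
    using that by (intro jt_norm_le) (simp add: le_diff_eq)
  then have "jt_norm ?y \<le> ?C - jt_norm ?x"
    by (intro jt_norm_le) (simp add: le_diff_eq add.commute)
  then show ?thesis by simp
qed

section \<open>The root vector and the slices it determines\<close>

lift_definition root_vec :: jt_infty is root_unit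
  by (rule root_unit_space)

lemma norm_root_vec: "norm root_vec = 1"
proof (transfer, rule antisym)
  show "jt_norm root_unit \<le> 1"
    using finitely_nonzero_bound[OF root_unit_finitely_nonzero]
    by (intro jt_norm_le) (simp add: root_unit_def)
  show "1 \<le> jt_norm root_unit"
    using coord_le_norm[OF root_unit_space, of "[]"] by (simp add: root_unit_def)
qed

lemma norm_root_vec_add_diff_le:
  assumes "norm z \<le> 1" "2 \<le> c"
  shows "norm (c *\<^sub>R root_vec + z) + norm (c *\<^sub>R root_vec - z) \<le> 2 * c + sqrt 2 + 1 / (c - 1)"
  using assms by transfer (rule jt_norm_root_add_diff_le)

text \<open>The coordinate functional at the root lies in the dual ball and takes the value
  \<open>1\<close> at \<open>root_vec\<close>. Hence members of the slice exceed
  \<open>1 - \<alpha>\<close> there.\<close>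

lemma SUP_root_vec_ge: "1 \<le> (SUP g\<in>cball 0 1. blinfun_apply g root_vec :: real)"
proof -
  have bl: "bounded_linear (\<lambda>z. jt_coord z [])"
  proof (rule bounded_linear_intro)
    show "norm (jt_coord z []) \<le> norm z * 1" for z
      using coord_le_norm[OF jt_coord] by (simp add: norm_jt_infty.rep_eq)
  qed (simp_all add: plus_jt_infty.rep_eq scaleR_jt_infty.rep_eq)
  let ?g = "Blinfun (\<lambda>z. jt_coord z [])"
  have "norm ?g \<le> 1"
    by (rule norm_blinfun_bound)
       (use coord_le_norm[OF jt_coord] in \<open>auto simp: bounded_linear_Blinfun_apply[OF bl] norm_jt_infty.rep_eq\<close>)
  \<comment> \<open>A real \<open>SUP\<close> dominates its members only when they are bounded
    above.\<close>
  moreover have "blinfun_apply g root_vec \<le> 1" if "g \<in> cball 0 1" for g :: "jt_infty \<Rightarrow>\<^sub>L real"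
    using norm_blinfun[of g root_vec] that by (simp add: norm_root_vec)
  ultimately have "blinfun_apply ?g root_vec \<le> (SUP g\<in>cball 0 1. blinfun_apply g root_vec)"
    by (intro cSUP_upper bdd_aboveI2) auto
  then show ?thesis
    by (simp add: bounded_linear_Blinfun_apply[OF bl] root_vec.rep_eq root_unit_def)
qed

lemma blinfun_apply_le_norm:
  fixes f :: "'a::real_normed_vector \<Rightarrow>\<^sub>L real"
  assumes "norm f \<le> 1"
  shows "blinfun_apply f z \<le> norm z"
  using norm_blinfun[of f z] mult_right_mono[OF assms, of "norm z"] by simp

lemma dist_root_slice_le:
  assumes f: "f \<in> wstar_slice (cball 0 1) root_vec \<alpha>" and g: "g \<in> wstar_slice (cball 0 1) root_vec \<alpha>"
    and c: "2 \<le> c" and "0 < \<alpha>"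
  shows "dist f g \<le> sqrt 2 + 1 / (c - 1) + 2 * c * \<alpha>"
proof -
  let ?d = "sqrt 2 + 1 / (c - 1) + 2 * c * \<alpha>"
  have d0: "0 \<le> ?d" using c \<open>0 < \<alpha>\<close> by simp
  have nf: "norm f \<le> 1" "norm g \<le> 1"
    using f g by (auto simp: wstar_slice_def)
  have "1 - \<alpha> \<le> blinfun_apply f root_vec" "1 - \<alpha> \<le> blinfun_apply g root_vec"
    using f g SUP_root_vec_ge by (auto simp: wstar_slice_def)
  then have fc: "c * (1 - \<alpha>) \<le> c * blinfun_apply f root_vec"
      "c * (1 - \<alpha>) \<le> c * blinfun_apply g root_vec"
    using c by (intro mult_left_mono; simp)+
  have ball: "blinfun_apply (f - g) z \<le> ?d" if z: "norm z \<le> 1" for z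
  proof -
    \<comment> \<open>Adding the two inequalities isolates \<open>(f - g) z\<close>, since by
      \<open>fc\<close> the terms at \<open>root_vec\<close> total at least
      \<open>2 * c * (1 - \<alpha>)\<close>.\<close>
    have "c * blinfun_apply f root_vec + blinfun_apply f z \<le> norm (c *\<^sub>R root_vec + z)"
      "c * blinfun_apply g root_vec - blinfun_apply g z \<le> norm (c *\<^sub>R root_vec - z)"
      using blinfun_apply_le_norm[OF nf(1), of "c *\<^sub>R root_vec + z"]
        blinfun_apply_le_norm[OF nf(2), of "c *\<^sub>R root_vec - z"]
      by (simp_all add: blinfun.add_right blinfun.diff_right blinfun.scaleR_right)
    then show ?thesis
      using norm_root_vec_add_diff_le[OF z c] fc
      by (simp add: blinfun.diff_left algebra_simps)
  qed
  have "norm (f - g) \<le> ?d"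
  proof (rule norm_blinfun_bound[OF d0])
    fix z
    show "norm (blinfun_apply (f - g) z) \<le> ?d * norm z"
    proof (cases "z = 0")
      case False
      \<comment> \<open>\<open>ball\<close> is one-sided; both signs together give the absolute
        value, and rescaling by \<open>norm z\<close> recovers \<open>z\<close>.\<close>
      then have "norm (sgn z) \<le> 1" "norm (- sgn z) \<le> 1" by (simp_all add: norm_sgn)
      then have "\<bar>blinfun_apply (f - g) (sgn z)\<bar> \<le> ?d"
        using ball[of "sgn z"] ball[of "- sgn z"] by (simp add: blinfun.minus_right)
      then have "norm z * \<bar>blinfun_apply (f - g) (sgn z)\<bar> \<le> norm z * ?d"
        by (rule mult_left_mono) simp
      moreover have "norm z * \<bar>blinfun_apply (f - g) (sgn z)\<bar> = \<bar>blinfun_apply (f - g) z\<bar>"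
        using False by (simp add: sgn_div_norm blinfun.scaleR_right abs_mult)
      ultimately show ?thesis by (simp only: real_norm_def mult.commute)
    qed simp
  qed
  then show ?thesis by (simp add: dist_norm)
qed

theorem theorem2p2:
  "\<exists>x :: jt_infty. norm x = 1 \<and>
     (INF \<alpha>\<in>{0<..}. diameter (wstar_slice (cball 0 1) x \<alpha>)) \<le> sqrt 2"
proof (intro exI conjI)
  show "norm root_vec = 1" by (rule norm_root_vec)
  let ?S = "wstar_slice (cball 0 1) root_vec"
  \<comment> \<open>Boundedness below lets a single \<open>\<alpha>\<close> bound the real
    \<open>INF\<close> from above.\<close>
  have bdd: "bdd_below ((\<lambda>\<alpha>. diameter (?S \<alpha>)) ` {0<..})"
  proof (rule bdd_belowI2)
    show "0 \<le> diameter (?S \<alpha>)" for \<alpha>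
      by (rule diameter_ge_0, rule bounded_subset[OF bounded_cball[of 0 1]])
         (unfold wstar_slice_def, blast)
  qed
  show "(INF \<alpha>\<in>{0<..}. diameter (?S \<alpha>)) \<le> sqrt 2"
  proof (rule field_le_epsilon)
    fix e :: real assume e: "0 < e"
    \<comment> \<open>First \<open>c\<close> is taken so large that
      \<open>1 / (c - 1) \<le> e / 2\<close>, then \<open>\<alpha>\<close> so small that
      \<open>2 * c * \<alpha> = e / 2\<close>.\<close>
    define c where "c = 2 + 2 / e"
    define \<alpha> where "\<alpha> = e / (4 * c)"
    have c: "2 \<le> c" using e by (simp add: c_def)
    have \<alpha>: "0 < \<alpha>" using e c by (simp add: \<alpha>_def)
    have "1 / (c - 1) \<le> e / 2" using e by (simp add: c_def field_simps)
    moreover have "2 * c * \<alpha> = e / 2" using c by (simp add: \<alpha>_def)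
    ultimately have le: "dist f g \<le> sqrt 2 + e" if "f \<in> ?S \<alpha>" "g \<in> ?S \<alpha>" for f g
      using dist_root_slice_le[OF that c \<alpha>] by linarith
    have "(INF \<alpha>\<in>{0<..}. diameter (?S \<alpha>)) \<le> diameter (?S \<alpha>)"
      by (rule cINF_lower[OF bdd]) (use \<alpha> in simp)
    also have "\<dots> \<le> sqrt 2 + e"
      by (rule diameter_le) (use le e in \<open>auto simp: dist_norm\<close>)
    finally show "(INF \<alpha>\<in>{0<..}. diameter (?S \<alpha>)) \<le> sqrt 2 + e" .
  qed
qed

end
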